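(* Let $C_0\in(0,1/4)$ be a universal constant such that for every integer $n\ge2$ and every $\varepsilon\in\mathbb R^n$ with $\|\varepsilon\|_2\le C_0$ one has $-\sum_{i=1}^n\frac1{\sqrt n}(\frac1{\sqrt n}+\varepsilon_i)\log|\frac1{\sqrt n}(\frac1{\sqrt n}+\varepsilon_i)|\ge\frac34\log n$ (with $0\log 0=0$). Then there is a universal constant $c>0$ such that the following holds. Let $n$ be a power of two, $F$ the $n\times n$ normalized Walsh–Hadamard matrix, $N\le n\log n$ a nonnegative integer, and $R>1$. Let a layered circuit of depth $m$ on $n+N$ variables be $R$-uniformly well conditioned, with final defining matrix $M_m$ satisfying $[M_m]_{[n],[n]}=F$ and $\|[M_m]_{[n+N]\setminus[n],[n]}\|\le C_0/R$ (spectral norm). Then $m\ge c\,R^{-1}n\log n$, i.e. $m=\Omega(R^{-1}n\log n)$.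
   Context: Logarithms are base $2$. The normalized Walsh–Hadamard matrix is $F(i,j)=n^{-1/2}(-1)^{\langle[i-1],[j-1]\rangle}$, with $[a]$ the binary representation of $a\in\{0,\dots,n-1\}$ and $\langle\cdot,\cdot\rangle$ the dot product over $\mathbb Z_2$. For a matrix $A$ and index sets $I,J$, $A_{I,J}$ is the submatrix with rows $I$, columns $J$; $[k]=\{1,\dots,k\}$. The first $n$ variables are the input, the other $N$ are extra memory initialized to $0$. A layered circuit of depth $m$ on $d$ variables has layers $L_0,\dots,L_m\in\mathbb R^d$ and gates $i=1,\dots,m$ of two types: a rotation gate (indices $k_i<\ell_i$ in $[d]$, angle $\theta_i$) leaves all coordinates except $k_i,\ell_i$ unchanged and sets $(L_i(k_i),L_i(\ell_i))^T=\begin{pmatrix}\cos\theta_i&\sin\theta_i\\-\sin\theta_i&\cos\theta_i\end{pmatrix}(L_{i-1}(k_i),L_{i-1}(\ell_i))^T$; a constant gate (index $k_i$, nonzero real $c_i$) multiplies coordinate $k_i$ by $c_i$ and leaves the others unchanged. The $i$-th defining matrix $M_i$ maps $L_0$ to $L_i$ ($M_0=\mathrm{Id}$). The circuit is $R$-uniformly well conditioned if $\max_{i\in[m]}\|M_i\|\|M_i^{-1}\|\le R$ (spectral norm). *)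

theory Defs
  imports
    "HOL-Analysis.L2_Norm"
    "Jordan_Normal_Form.Gauss_Jordan_Elimination"
    "Jordan_Normal_Form.Determinant"
    "Jordan_Normal_Form.DL_Submatrix"
begin

text \<open>Coordinates, rows and columns are numbered from 0, so the index set \<open>[n]\<close> is \<open>{..<n}\<close>.\<close>

definition l2_norm :: "real vec \<Rightarrow> real" where
  "l2_norm v = L2_set (vec_index v) {..<dim_vec v}"

text \<open>The operator norm for the Euclidean norms. The closed unit ball (rather than the sphere)
  keeps the supremum over a nonempty set in every dimension; a matrix with no rows has norm 0.\<close>

definition spectral_norm :: "real mat \<Rightarrow> real" where
  "spectral_norm A = Sup {l2_norm (A *\<^sub>v v) | v. v \<in> carrier_vec (dim_col A) \<and> l2_norm v \<le> 1}"

lemma spectral_norm_bdd_above: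
  "bdd_above {l2_norm (A *\<^sub>v v) | v. v \<in> carrier_vec (dim_col A) \<and> l2_norm v \<le> 1}"
proof (rule bdd_aboveI)
  fix x assume "x \<in> {l2_norm (A *\<^sub>v v) | v. v \<in> carrier_vec (dim_col A) \<and> l2_norm v \<le> 1}"
  then obtain v where v: "v \<in> carrier_vec (dim_col A)" "l2_norm v \<le> 1"
    and x: "x = l2_norm (A *\<^sub>v v)" by blast
  have entry: "\<bar>v $ j\<bar> \<le> 1" if "j < dim_col A" for j
  proof -
    have "\<bar>v $ j\<bar> \<le> L2_set (\<lambda>j. \<bar>v $ j\<bar>) {..<dim_vec v}"
      by (rule member_le_L2_set) (use that v in auto)
    then have "\<bar>v $ j\<bar> \<le> l2_norm v" by (simp add: l2_norm_def L2_set_def)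
    then show ?thesis using v(2) by linarith
  qed
  have "x \<le> (\<Sum>i<dim_row A. \<bar>(A *\<^sub>v v) $ i\<bar>)"
    unfolding x l2_norm_def using L2_set_le_sum_abs[of "vec_index (A *\<^sub>v v)"]
    by (simp del: index_mult_mat_vec)
  also have "\<dots> \<le> (\<Sum>i<dim_row A. \<Sum>j<dim_col A. \<bar>A $$ (i, j)\<bar>)"
  proof (rule sum_mono)
    fix i assume i: "i \<in> {..<dim_row A}"
    have "(A *\<^sub>v v) $ i = (\<Sum>j<dim_col A. A $$ (i, j) * v $ j)"
      using i v(1) by (auto simp: scalar_prod_def atLeast0LessThan intro!: sum.cong)
    also have "\<bar>\<dots>\<bar> \<le> (\<Sum>j<dim_col A. \<bar>A $$ (i, j) * v $ j\<bar>)" by (rule sum_abs)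
    also have "\<dots> \<le> (\<Sum>j<dim_col A. \<bar>A $$ (i, j)\<bar>)"
      by (rule sum_mono) (use entry in \<open>auto simp: abs_mult intro: mult_left_le\<close>)
    finally show "\<bar>(A *\<^sub>v v) $ i\<bar> \<le> (\<Sum>j<dim_col A. \<bar>A $$ (i, j)\<bar>)" .
  qed
  finally show "x \<le> (\<Sum>i<dim_row A. \<Sum>j<dim_col A. \<bar>A $$ (i, j)\<bar>)" .
qed

text \<open>The dot product over the two-element field of the \<open>p\<close>-bit binary representations
  of two numbers below \<open>2 ^ p\<close>.\<close>

definition bit_dot :: "nat \<Rightarrow> nat \<Rightarrow> nat \<Rightarrow> nat" where
  "bit_dot p a b = (\<Sum>t<p. of_bool (bit a t) * of_bool (bit b t)) mod 2"

definition walsh_hadamard :: "nat \<Rightarrow> real mat" where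
  "walsh_hadamard p = mat (2 ^ p) (2 ^ p) (\<lambda>(i, j). (- 1) ^ bit_dot p i j / sqrt (2 ^ p))"

datatype gate = Rotation nat nat real | Constant nat real

fun valid_gate :: "nat \<Rightarrow> gate \<Rightarrow> bool" where
  "valid_gate d (Rotation k l \<theta>) \<longleftrightarrow> k < l \<and> l < d"
| "valid_gate d (Constant k c) \<longleftrightarrow> k < d \<and> c \<noteq> 0"

fun apply_gate :: "gate \<Rightarrow> real vec \<Rightarrow> real vec" where
  "apply_gate (Rotation k l \<theta>) v = vec (dim_vec v) (\<lambda>i.
     if i = k then cos \<theta> * v $ k + sin \<theta> * v $ l
     else if i = l then - sin \<theta> * v $ k + cos \<theta> * v $ l
     else v $ i)"
| "apply_gate (Constant k c) v = vec (dim_vec v) (\<lambda>i. if i = k then c * v $ k else v $ i)"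

text \<open>A circuit is the list of its gates, its depth is the length of the list, and
  \<open>layer gs x i\<close> is its \<open>i\<close>-th layer for the initial layer \<open>x\<close>.\<close>

definition layered_circuit :: "nat \<Rightarrow> gate list \<Rightarrow> bool" where
  "layered_circuit d gs \<longleftrightarrow> (\<forall>g\<in>set gs. valid_gate d g)"

definition layer :: "gate list \<Rightarrow> real vec \<Rightarrow> nat \<Rightarrow> real vec" where
  "layer gs x i = fold apply_gate (take i gs) x"

text \<open>Column \<open>s\<close> is the image of the \<open>s\<close>-th unit vector; by \<open>defining_matrix_unique\<close>
  this is the one matrix mapping the initial layer to the \<open>i\<close>-th layer.\<close>

definition defining_matrix :: "nat \<Rightarrow> gate list \<Rightarrow> nat \<Rightarrow> real mat" where
  "defining_matrix d gs i = mat d d (\<lambda>(r, s). layer gs (unit_vec d s) i $ r)"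

text \<open>The inverses exist by \<open>mat_inverse_defining_matrix\<close>. The condition on the maximum over
  \<open>i\<close> is written as a condition on every \<open>i\<close>, so it is vacuous at depth 0.\<close>

definition uniformly_well_conditioned :: "real \<Rightarrow> nat \<Rightarrow> gate list \<Rightarrow> bool" where
  "uniformly_well_conditioned R d gs \<longleftrightarrow>
    (\<forall>i\<in>{1..length gs}.
       spectral_norm (defining_matrix d gs i) *
       spectral_norm (the (mat_inverse (defining_matrix d gs i))) \<le> R)"

definition gate_mat :: "nat \<Rightarrow> gate \<Rightarrow> real mat" where
  "gate_mat d g = mat d d (\<lambda>(r, s). apply_gate g (unit_vec d s) $ r)"

lemma gate_mat_carrier [simp]: "gate_mat d g \<in> carrier_mat d d"
  by (simp add: gate_mat_def)

lemma dim_apply_gate [simp]: "dim_vec (apply_gate g x) = dim_vec x"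
  by (cases g) auto

lemma apply_gate_carrier: "x \<in> carrier_vec d \<Longrightarrow> apply_gate g x \<in> carrier_vec d"
  by (intro carrier_vecI) simp

lemma fold_apply_gate_carrier: "x \<in> carrier_vec d \<Longrightarrow> fold apply_gate gs x \<in> carrier_vec d"
  by (induction gs arbitrary: x) (auto intro: apply_gate_carrier)

lemma sum_mult_unit_vec:
  fixes v :: "real vec"
  assumes "k < d"
  shows "(\<Sum>s<d. a * unit_vec d s $ k * v $ s) = a * v $ k"
proof -
  have "(\<Sum>s<d. a * unit_vec d s $ k * v $ s) = (\<Sum>s<d. if s = k then a * v $ k else 0)"
    using assms by (intro sum.cong) auto
  then show ?thesis using assms by simp
qed

lemma gate_mat_apply:
  assumes "valid_gate d g" and x: "x \<in> carrier_vec d"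
  shows "gate_mat d g *\<^sub>v x = apply_gate g x"
proof (rule eq_vecI)
  show "dim_vec (gate_mat d g *\<^sub>v x) = dim_vec (apply_gate g x)"
    using x by (simp add: gate_mat_def)
  fix r assume "r < dim_vec (apply_gate g x)"
  then have r: "r < d" using x by simp
  have *: "(gate_mat d g *\<^sub>v x) $ r = (\<Sum>s<d. apply_gate g (unit_vec d s) $ r * x $ s)"
    using r x by (auto simp: gate_mat_def scalar_prod_def atLeast0LessThan intro!: sum.cong)
  have unit: "(\<Sum>s<d. unit_vec d s $ j * x $ s) = x $ j" if "j < d" for j
    using sum_mult_unit_vec[OF that, of 1 x] by simp
  show "(gate_mat d g *\<^sub>v x) $ r = apply_gate g x $ r"
  proof (cases g)
    case (Rotation k l \<theta>)
    then have kl: "k < d" "l < d" using assms by auto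
    have lin: "(\<Sum>s<d. (a * unit_vec d s $ k + b * unit_vec d s $ l) * x $ s) = a * x $ k + b * x $ l"
      for a b
      unfolding distrib_right sum.distrib
      by (simp only: sum_mult_unit_vec[OF kl(1)] sum_mult_unit_vec[OF kl(2)])
    consider "r = k" | "r \<noteq> k" "r = l" | "r \<noteq> k" "r \<noteq> l" by blast
    then show ?thesis
    proof cases
      case 1
      then show ?thesis
        unfolding * using Rotation x r kl lin[of "cos \<theta>" "sin \<theta>"] by (simp add: index_unit_vec(3) del: index_unit_vec(1,2))
    next
      case 2
      then show ?thesis
        unfolding * using Rotation x r kl lin[of "- sin \<theta>" "cos \<theta>"] by (simp add: index_unit_vec(3) del: index_unit_vec(1,2))
    next
      case 3
      then show ?thesis
        unfolding * using Rotation x r unit[OF r] by (simp add: index_unit_vec(3) del: index_unit_vec(1,2))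
    qed
  next
    case (Constant k c)
    then have "k < d" using assms by auto
    then show ?thesis
      unfolding * using r x Constant sum_mult_unit_vec[of k d c x] unit[OF r]
      by (cases "r = k") (simp_all add: index_unit_vec(3) del: index_unit_vec(1,2))
  qed
qed

lemma layer_eq_prod:
  assumes "layered_circuit d gs"
  shows "\<exists>A\<in>carrier_mat d d. \<forall>x\<in>carrier_vec d. layer gs x i = A *\<^sub>v x"
proof -
  have "\<exists>A\<in>carrier_mat d d. \<forall>x\<in>carrier_vec d. fold apply_gate hs x = A *\<^sub>v x"
    if "\<forall>h\<in>set hs. valid_gate d h" for hs
    using that
  proof (induction hs rule: rev_induct)
    case Nil
    show ?case by (rule bexI[of _ "1\<^sub>m d"]) auto
  next
    case (snoc h hs)
    then obtain A where A: "A \<in> carrier_mat d d"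
      "\<forall>x\<in>carrier_vec d. fold apply_gate hs x = A *\<^sub>v x"
      by auto
    show ?case
    proof (intro bexI[of _ "gate_mat d h * A"] ballI)
      show "gate_mat d h * A \<in> carrier_mat d d" by (rule mult_carrier_mat[OF gate_mat_carrier A(1)])
      fix x :: "real vec" assume x: "x \<in> carrier_vec d"
      have "apply_gate h (A *\<^sub>v x) = gate_mat d h *\<^sub>v (A *\<^sub>v x)"
        using snoc.prems A x by (intro gate_mat_apply[symmetric]) auto
      then show "fold apply_gate (hs @ [h]) x = (gate_mat d h * A) *\<^sub>v x"
        using A x by (simp add: assoc_mult_mat_vec[OF gate_mat_carrier A(1) x])
    qed
  qed
  then show ?thesis
    using assms unfolding layered_circuit_def layer_def by (meson in_set_takeD)
qed

lemma mat_eq_defining_matrix: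
  assumes A: "A \<in> carrier_mat d d" and Ax: "\<forall>x\<in>carrier_vec d. A *\<^sub>v x = layer gs x i"
  shows "A = defining_matrix d gs i"
proof (rule eq_matI)
  fix r s assume "r < dim_row (defining_matrix d gs i)" "s < dim_col (defining_matrix d gs i)"
  then have rs: "r < d" "s < d" by (auto simp: defining_matrix_def)
  have "layer gs (unit_vec d s) i = A *\<^sub>v unit_vec d s"
    using Ax by simp
  also have "\<dots> = col A s"
    using A rs by (intro eq_vecI) auto
  finally show "A $$ (r, s) = defining_matrix d gs i $$ (r, s)"
    using A rs by (simp add: defining_matrix_def)
qed (use A in \<open>auto simp: defining_matrix_def\<close>)

lemma defining_matrix_unique:
  assumes "layered_circuit d gs"
  shows "A \<in> carrier_mat d d \<and> (\<forall>x\<in>carrier_vec d. A *\<^sub>v x = layer gs x i) \<longleftrightarrow>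
    A = defining_matrix d gs i"
  using layer_eq_prod[OF assms, of i] mat_eq_defining_matrix by metis

lemma apply_gate_inverse:
  assumes "valid_gate d g"
  obtains g' where "valid_gate d g'"
    and "\<And>x. x \<in> carrier_vec d \<Longrightarrow> apply_gate g' (apply_gate g x) = x"
proof (cases g)
  case (Rotation k l \<theta>)
  have one: "sin \<theta> * sin \<theta> + cos \<theta> * cos \<theta> = 1"
    using sin_cos_squared_add[of \<theta>] by (simp add: power2_eq_square)
  have alg: "q * (q * a + p * b) - p * (q * b - p * a) = a"
    "p * (q * a + p * b) + q * (q * b - p * a) = b" if "p * p + q * q = 1" for a b p q :: real
  proof -
    have "q * (q * a + p * b) - p * (q * b - p * a) = (p * p + q * q) * a"
      "p * (q * a + p * b) + q * (q * b - p * a) = (p * p + q * q) * b"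
      by (simp_all only: algebra_simps)
    then show "q * (q * a + p * b) - p * (q * b - p * a) = a"
      "p * (q * a + p * b) + q * (q * b - p * a) = b" by (simp_all only: that mult_1)
  qed
  note rot1 = alg(1)[OF one] and rot2 = alg(2)[OF one]
  have kl: "k < l" "l < d" using assms Rotation by auto
  have "apply_gate (Rotation k l (- \<theta>)) (apply_gate g x) $ i = x $ i"
    if x: "x \<in> carrier_vec d" and i: "i < d" for x i
  proof -
    consider "i = k" | "i = l" "i \<noteq> k" | "i \<noteq> k" "i \<noteq> l" by blast
    then show ?thesis
    proof cases
      case 1
      then show ?thesis using x i kl Rotation rot1[of "x $ k" "x $ l"] by simp
    next
      case 2
      then show ?thesis using x i kl Rotation rot2[of "x $ k" "x $ l"] by simp
    next
      case 3
      then show ?thesis using x i kl Rotation by simp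
    qed
  qed
  then show ?thesis
    using kl by (intro that[of "Rotation k l (- \<theta>)"] eq_vecI) (auto simp del: apply_gate.simps)
next
  case (Constant k c)
  have "apply_gate (Constant k (inverse c)) (apply_gate g x) $ i = x $ i"
    if "x \<in> carrier_vec d" "i < d" for x i
    using that assms Constant by (cases "i = k") simp_all
  then show ?thesis
    using assms Constant
    by (intro that[of "Constant k (inverse c)"] eq_vecI) (auto simp del: apply_gate.simps)
qed

lemma mat_inverse_defining_matrix:
  assumes "layered_circuit d gs"
  shows "\<exists>B\<in>carrier_mat d d. mat_inverse (defining_matrix d gs i) = Some B"
proof -
  let ?M = "defining_matrix d gs i"
  have M: "?M \<in> carrier_mat d d" and Mx: "\<And>x. x \<in> carrier_vec d \<Longrightarrow> ?M *\<^sub>v x = layer gs x i"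
    using defining_matrix_unique[OF assms, of ?M i] by auto
  have "\<exists>hs. layered_circuit d hs \<and> (\<forall>x\<in>carrier_vec d. fold apply_gate hs (fold apply_gate gs' x) = x)"
    if "layered_circuit d gs'" for gs'
    using that
  proof (induction gs')
    case Nil
    show ?case by (rule exI[of _ "[]"]) (simp add: layered_circuit_def)
  next
    case (Cons g gs')
    then obtain hs where hs: "layered_circuit d hs"
      "\<forall>x\<in>carrier_vec d. fold apply_gate hs (fold apply_gate gs' x) = x"
      by (auto simp: layered_circuit_def)
    obtain g' where g': "valid_gate d g'"
      "\<And>x. x \<in> carrier_vec d \<Longrightarrow> apply_gate g' (apply_gate g x) = x"
      using apply_gate_inverse[of d g] Cons.prems by (auto simp: layered_circuit_def)
    show ?case
      by (rule exI[of _ "hs @ [g']"])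
        (use hs g' in \<open>auto simp: layered_circuit_def apply_gate_carrier\<close>)
  qed
  moreover have "layered_circuit d (take i gs)"
    using assms by (auto simp: layered_circuit_def dest: in_set_takeD)
  ultimately obtain hs where hs: "layered_circuit d hs"
    "\<forall>x\<in>carrier_vec d. fold apply_gate hs (layer gs x i) = x"
    unfolding layer_def by blast
  let ?B = "defining_matrix d hs (length hs)"
  have B: "?B \<in> carrier_mat d d" and Bx: "\<And>x. x \<in> carrier_vec d \<Longrightarrow> ?B *\<^sub>v x = fold apply_gate hs x"
    using defining_matrix_unique[OF hs(1), of ?B "length hs"] by (auto simp: layer_def)
  have "(?B * ?M) *\<^sub>v x = x" if x: "x \<in> carrier_vec d" for x
    using hs(2) x Mx[OF x] fold_apply_gate_carrier[OF x, of "take i gs"] Bx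
    by (simp add: assoc_mult_mat_vec[OF B M x] layer_def)
  then have "?B * ?M = defining_matrix d [] 0" "1\<^sub>m d = defining_matrix d [] 0"
    using B M by (intro mat_eq_defining_matrix; simp add: layer_def)+
  then have BM: "?B * ?M = 1\<^sub>m d" by simp
  then have "?M \<in> Units (ring_mat TYPE(real) d ())"
    using B M mat_mult_left_right_inverse[OF B M BM] by (auto simp: Units_def ring_mat_def)
  then show ?thesis
    using mat_inverse(1)[OF M, of "()"] mat_inverse(2)[OF M] by (cases "mat_inverse ?M") auto
qed

end

theory Submission
  imports Defs
begin

text \<open>Attach to an invertible matrix \<open>M\<close> with inverse \<open>V\<close> the potential
  \<open>\<Phi> = - (\<Sum>r<n+N. \<Sum>s<n. t\<^bsub>rs\<^esub> log |t\<^bsub>rs\<^esub>|)\<close> with \<open>t\<^bsub>rs\<^esub> = M\<^bsub>rs\<^esub> V\<^bsub>sr\<^esub>\<close>.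
  It vanishes at the identity and a constant gate leaves every \<open>t\<^bsub>rs\<^esub>\<close> unchanged. A rotation gate
  changes two rows of \<open>M\<close> and two columns of \<open>V\<close> by the same rotation, which preserves the sum of
  the two affected \<open>t\<^bsub>rs\<^esub>\<close> for each \<open>s\<close>; hence \<open>t log |t|\<close> only matters up to scaling, and
  Cauchy--Schwarz bounds the change of \<open>\<Phi>\<close> by \<open>16 \<parallel>M\<parallel> \<parallel>V\<parallel> \<le> 16 R\<close>.
  For the final matrix, \<open>V\<close> is so close to the transposed Hadamard matrix on the first \<open>n\<close> coordinates
  that these contribute at least \<open>3/4 n log n\<close> to \<open>\<Phi>\<close>. On the memory coordinates the total mass of the
  \<open>|t\<^bsub>rs\<^esub>|\<close> is at most \<open>C0 n < n/4\<close>, and comparing with the threshold \<open>1/n\<^sup>2\<close> they contribute at least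
  \<open>- (n log n / 2 + 2 log n)\<close>. For \<open>n < 16\<close> it suffices that the circuit is not empty.\<close>

section \<open>Spectral norms\<close>

lemma l2_norm_nonneg: "0 \<le> l2_norm v"
  by (simp add: l2_norm_def)

lemma l2_norm_smult: "l2_norm (c \<cdot>\<^sub>v v) = \<bar>c\<bar> * l2_norm v"
  using L2_set_right_distrib[of "\<bar>c\<bar>" "vec_index v" "{..<dim_vec v}"]
  by (simp add: l2_norm_def L2_set_def power_mult_distrib)

lemma abs_index_le_l2_norm:
  assumes "i < dim_vec v"
  shows "\<bar>v $ i\<bar> \<le> l2_norm v"
proof -
  have "\<bar>v $ i\<bar> \<le> L2_set (\<lambda>j. \<bar>v $ j\<bar>) {..<dim_vec v}"
    by (rule member_le_L2_set) (use assms in auto)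
  then show ?thesis by (simp add: l2_norm_def L2_set_def)
qed

lemma l2_norm_mult_unit_le:
  assumes "v \<in> carrier_vec (dim_col A)" "l2_norm v \<le> 1"
  shows "l2_norm (A *\<^sub>v v) \<le> spectral_norm A"
  unfolding spectral_norm_def
  by (rule cSup_upper[OF _ spectral_norm_bdd_above]) (use assms in blast)

lemma l2_norm_mult_le:
  assumes v: "v \<in> carrier_vec (dim_col A)"
  shows "l2_norm (A *\<^sub>v v) \<le> spectral_norm A * l2_norm v"
proof (cases "l2_norm v = 0")
  case True
  then have "v $ i = 0" if "i < dim_vec v" for i
    using abs_index_le_l2_norm[OF that] by simp
  then have "v = 0\<^sub>v (dim_col A)" using v by (intro eq_vecI) auto
  then have "A *\<^sub>v v = 0\<^sub>v (dim_row A)" by (intro eq_vecI) auto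
  then show ?thesis using True by (simp add: l2_norm_def L2_set_def)
next
  case False
  then have pos: "0 < l2_norm v" using l2_norm_nonneg[of v] by simp
  let ?u = "inverse (l2_norm v) \<cdot>\<^sub>v v"
  have u: "?u \<in> carrier_vec (dim_col A)" "l2_norm ?u \<le> 1"
    using v pos by (auto simp: l2_norm_smult)
  have "A *\<^sub>v ?u = inverse (l2_norm v) \<cdot>\<^sub>v (A *\<^sub>v v)"
    using v by (intro eq_vecI) auto
  then have "inverse (l2_norm v) * l2_norm (A *\<^sub>v v) \<le> spectral_norm A"
    using l2_norm_mult_unit_le[OF u] pos by (simp add: l2_norm_smult)
  then show ?thesis using pos by (simp add: field_simps)
qed

lemma spectral_norm_nonneg: "0 \<le> spectral_norm A"
proof -
  have "l2_norm (0\<^sub>v (dim_col A)) \<le> 1" by (simp add: l2_norm_def L2_set_def)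
  then show ?thesis
    using l2_norm_mult_unit_le[of "0\<^sub>v (dim_col A)" A] l2_norm_nonneg[of "A *\<^sub>v 0\<^sub>v (dim_col A)"]
    by simp
qed

lemma l2_norm_unit_vec:
  assumes "j < d"
  shows "l2_norm (unit_vec d j) = 1"
proof -
  have "(\<Sum>i<d. (unit_vec d j $ i :: real)\<^sup>2) = (\<Sum>i<d. if i = j then 1 else 0)"
    using assms by (intro sum.cong) auto
  then show ?thesis using assms by (simp add: l2_norm_def L2_set_def)
qed

lemma column_le_spectral_norm:
  assumes "j < dim_col A"
  shows "(\<Sum>i<dim_row A. (A $$ (i, j))\<^sup>2) \<le> (spectral_norm A)\<^sup>2"
proof -
  have "l2_norm (A *\<^sub>v unit_vec (dim_col A) j) \<le> spectral_norm A"
    by (rule l2_norm_mult_unit_le) (use assms l2_norm_unit_vec in auto)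
  moreover have "l2_norm (A *\<^sub>v unit_vec (dim_col A) j) = sqrt (\<Sum>i<dim_row A. (A $$ (i, j))\<^sup>2)"
    using assms by (simp add: l2_norm_def L2_set_def)
  ultimately show ?thesis by (metis sqrt_le_D)
qed

text \<open>Applied to its own row \<open>v = row A i\<close>, the matrix produces
  \<open>(l2_norm v)\<^sup>2\<close> as entry \<open>i\<close>. Hence
  \<open>(l2_norm v)\<^sup>2 \<le> spectral_norm A * l2_norm v\<close>, and a nonzero
  \<open>l2_norm v\<close> cancels.\<close>

lemma row_le_spectral_norm:
  assumes i: "i < dim_row A"
  shows "(\<Sum>j<dim_col A. (A $$ (i, j))\<^sup>2) \<le> (spectral_norm A)\<^sup>2"
proof -
  let ?v = "row A i" and ?S = "\<Sum>j<dim_col A. (A $$ (i, j))\<^sup>2"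
  have S: "l2_norm ?v = sqrt ?S"
    using i by (simp add: l2_norm_def L2_set_def)
  have "(A *\<^sub>v ?v) $ i = ?S"
    using i by (auto simp: scalar_prod_def power2_eq_square atLeast0LessThan intro!: sum.cong)
  moreover have "\<bar>(A *\<^sub>v ?v) $ i\<bar> \<le> l2_norm (A *\<^sub>v ?v)"
    by (rule abs_index_le_l2_norm) (use i in simp)
  moreover have "l2_norm (A *\<^sub>v ?v) \<le> spectral_norm A * l2_norm ?v"
    by (rule l2_norm_mult_le) (use i in simp)
  ultimately have "sqrt ?S * sqrt ?S \<le> spectral_norm A * sqrt ?S"
    using S by (simp add: sum_nonneg)
  then have "sqrt ?S \<le> spectral_norm A"
    using spectral_norm_nonneg[of A] mult_right_le_imp_le[of "sqrt ?S" "sqrt ?S" "spectral_norm A"]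
      sum_nonneg[of "{..<dim_col A}" "\<lambda>j. (A $$ (i, j))\<^sup>2"]
    by (cases "?S = 0") (simp_all add: less_le)
  then show ?thesis by (metis sqrt_le_D)
qed

section \<open>The function \<open>t log |t|\<close>\<close>

text \<open>The sign of \<open>t\<close> stays outside the logarithm, so that in
  \<open>tlog_scale\<close> the coefficient of \<open>log 2 s\<close> is linear in \<open>t\<close>
  and cancels between equal signed sums. At 0 the value is 0, the convention for entropies.\<close>

definition tlog :: "real \<Rightarrow> real" where
  "tlog t = t * log 2 \<bar>t\<bar>"

lemma half_le_ln_2: "1 / 2 \<le> ln (2::real)"
  using ln_add_one_self_le_self2[of "- (1/2)"] by (simp add: ln_div)

text \<open>From \<open>ln x \<le> x - 1\<close> at \<open>x = 1 / t\<close> one gets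
  \<open>- (t * ln t) \<le> 1 - t \<le> 1\<close>; passing to base 2 costs the factor
  \<open>1 / ln 2 \<le> 2\<close>.\<close>

lemma neg_tlog_le_2:
  assumes "0 \<le> t"
  shows "- tlog t \<le> 2"
proof (cases "t = 0")
  case False
  then have t: "0 < t" using assms by simp
  have "t * ln (1 / t) \<le> t * (1 / t - 1)"
    using t by (intro mult_left_mono ln_le_minus_one) auto
  also have "\<dots> \<le> 1" using t by (simp add: field_simps)
  also have "\<dots> \<le> 2 * ln 2" using half_le_ln_2 by simp
  finally have "- (t * ln t) \<le> 2 * ln 2" using t by (simp add: ln_div)
  then show ?thesis
    using t half_le_ln_2 by (simp add: tlog_def log_def field_simps)
qed (simp add: tlog_def)

lemma abs_tlog_eq:
  assumes "\<bar>t\<bar> \<le> 1"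
  shows "\<bar>tlog t\<bar> = - tlog \<bar>t\<bar>"
proof (cases "t = 0")
  case False
  then have "log 2 \<bar>t\<bar> \<le> 0" using assms by simp
  then show ?thesis by (simp add: tlog_def abs_mult)
qed (simp add: tlog_def)

lemma abs_tlog_le_2:
  assumes "\<bar>t\<bar> \<le> 1"
  shows "\<bar>tlog t\<bar> \<le> 2"
  using abs_tlog_eq[OF assms] neg_tlog_le_2[of "\<bar>t\<bar>"] by simp

lemma tlog_scale:
  assumes "0 < s"
  shows "tlog t = t * log 2 s + s * tlog (t / s)"
  using assms by (cases "t = 0") (simp_all add: tlog_def log_divide field_simps)

text \<open>Dividing all four numbers by \<open>s\<close> with \<open>tlog_scale\<close> leaves a
  linear part, which cancels because the sums agree, and four values of \<open>tlog\<close> on the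
  interval from -1 to 1, each at most 2 in absolute value. The bound is therefore free of
  logarithms.\<close>

lemma tlog_exchange:
  assumes sum: "x + y = u + v"
    and bounds: "\<bar>x\<bar> \<le> s" "\<bar>y\<bar> \<le> s" "\<bar>u\<bar> \<le> s" "\<bar>v\<bar> \<le> s"
  shows "\<bar>tlog x + tlog y - (tlog u + tlog v)\<bar> \<le> 8 * s"
proof (cases "s = 0")
  case True
  then show ?thesis using bounds by simp
next
  case False
  then have s: "0 < s" using bounds by linarith
  have b: "\<bar>tlog (t / s)\<bar> \<le> 2" if "\<bar>t\<bar> \<le> s" for t
    by (rule abs_tlog_le_2) (use that s in simp)
  let ?D = "tlog (x / s) + tlog (y / s) - (tlog (u / s) + tlog (v / s))"
  have "tlog x + tlog y - (tlog u + tlog v) = (x + y - (u + v)) * log 2 s + s * ?D"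
    unfolding tlog_scale[OF s, of x] tlog_scale[OF s, of y] tlog_scale[OF s, of u]
      tlog_scale[OF s, of v] by (simp add: algebra_simps)
  also have "\<dots> = s * ?D" using sum by simp
  finally have "tlog x + tlog y - (tlog u + tlog v) = s * ?D" .
  moreover have "\<bar>?D\<bar> \<le> 8"
    using b[OF bounds(1)] b[OF bounds(2)] b[OF bounds(3)] b[OF bounds(4)] by linarith
  ultimately show ?thesis using s by (simp add: abs_mult)
qed

text \<open>Use \<open>tlog_scale\<close> with \<open>s = \<tau>\<close>: the linear part is
  proportional to the mass \<open>\<bar>t\<bar>\<close>, and the rest is at most
  \<open>2 * \<tau>\<close> because \<open>- tlog\<close> is at most 2 on the whole nonnegative
  half-line. Many tiny terms thus cost little.\<close>

lemma abs_tlog_le_threshold: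
  assumes "\<bar>t\<bar> \<le> 1" "0 < \<tau>"
  shows "\<bar>tlog t\<bar> \<le> \<bar>t\<bar> * log 2 (1 / \<tau>) + 2 * \<tau>"
proof -
  have "\<tau> * - tlog (\<bar>t\<bar> / \<tau>) \<le> \<tau> * 2"
    using assms by (intro mult_left_mono neg_tlog_le_2) auto
  then show ?thesis
    using abs_tlog_eq[OF assms(1)] tlog_scale[OF assms(2), of "\<bar>t\<bar>"] assms(2)
    by (simp add: log_divide)
qed

section \<open>Orthogonality of the Walsh--Hadamard matrix\<close>

text \<open>Distributivity: expanding the product on the right chooses one bit for each
  \<open>t < p\<close>, and the choices are the binary expansions of the numbers below
  \<open>2 ^ p\<close>. The induction splits off the top bit.\<close>

lemma sum_prod_bits:
  fixes g :: "nat \<Rightarrow> bool \<Rightarrow> 'a :: comm_semiring_1"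
  shows "(\<Sum>j<2 ^ p. \<Prod>t<p. g t (bit (j::nat) t)) = (\<Prod>t<p. g t False + g t True)"
proof (induction p)
  case 0
  show ?case by (simp add: lessThan_Suc)
next
  case (Suc p)
  let ?h = "\<lambda>j::nat. \<Prod>t<Suc p. g t (bit j t)"
  \<comment> \<open>Below \<open>2 ^ p\<close> bit \<open>p\<close> is unset, so adding
    \<open>2 ^ p\<close> causes no carry and only sets that bit.\<close>
  have bit: "bit (j + 2 ^ p) t \<longleftrightarrow> t = p \<or> bit j t" "\<not> bit j p" if "j < 2 ^ p" "t \<le> p" for j t :: nat
  proof -
    have np: "\<not> bit j t'" if "p \<le> t'" for t'
      using \<open>j < 2 ^ p\<close> that by (metis bit_take_bit_iff not_less take_bit_nat_eq_self)
    then show "\<not> bit j p" by simp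
    have "j + 2 ^ p = or j (2 ^ p)"
      by (rule disjunctive_add) (use np in \<open>auto simp: bit_simps\<close>)
    then show "bit (j + 2 ^ p) t \<longleftrightarrow> t = p \<or> bit j t" by (auto simp: bit_simps)
  qed
  have "{..<2 ^ Suc p} = {..<2 ^ p} \<union> (\<lambda>j. j + 2 ^ p) ` {..<2 ^ p :: nat}" (is "?A = ?B")
  proof (intro equalityI subsetI)
    fix x assume "x \<in> ?A"
    then show "x \<in> ?B"
      by (cases "x < 2 ^ p") (auto intro!: image_eqI[of _ _ "x - 2 ^ p"])
  qed auto
  then have "sum ?h {..<2 ^ Suc p} = sum ?h {..<2 ^ p} + sum ?h ((\<lambda>j. j + 2 ^ p) ` {..<2 ^ p :: nat})"
    by (simp only:) (rule sum.union_disjoint, auto)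
  also have "sum ?h ((\<lambda>j. j + 2 ^ p) ` {..<2 ^ p :: nat}) = (\<Sum>j<2 ^ p :: nat. ?h (j + 2 ^ p))"
    by (subst sum.reindex) (auto simp: inj_on_def)
  also have "\<dots> = (\<Sum>j<2 ^ p :: nat. (\<Prod>t<p. g t (bit j t)) * g p True)"
    using bit(1) by (intro sum.cong) (auto intro!: prod.cong arg_cong2[where f = "(*)"])
  also have "sum ?h {..<2 ^ p} = (\<Sum>j<2 ^ p :: nat. (\<Prod>t<p. g t (bit j t)) * g p False)"
    using bit(2)[OF _ le_refl] by (intro sum.cong) auto
  finally show ?case
    by (simp add: Suc.IH[symmetric] sum_distrib_right distrib_left)
qed

definition bit_sign :: "bool \<Rightarrow> bool \<Rightarrow> real" where
  "bit_sign a b = (if a \<and> b then - 1 else 1)"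

lemma minus_one_power_bit_dot:
  "(- 1) ^ bit_dot p a b = (\<Prod>t<p. bit_sign (bit a t) (bit b t))"
proof -
  have mod2: "(- 1 :: real) ^ (x mod 2) = (- 1) ^ x" for x :: nat
    by (cases "even x") (auto simp: parity_cases odd_iff_mod_2_eq_one)
  have "(- 1 :: real) ^ bit_dot p a b =
      (\<Prod>t<p. (- 1) ^ (of_bool (bit a t) * of_bool (bit b t)))"
    unfolding bit_dot_def by (simp only: mod2 power_sum)
  also have "\<dots> = (\<Prod>t<p. bit_sign (bit a t) (bit b t))"
    by (intro prod.cong) (auto simp: bit_sign_def)
  finally show ?thesis .
qed

text \<open>The product of two rows is a product of functions of single bits of \<open>j\<close>, so
  the sum factorizes. A position where \<open>i\<close> and \<open>k\<close> agree gives the factor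
  2, one where they differ gives 1 - 1 = 0.\<close>

lemma bit_dot_orthogonal:
  assumes "i < 2 ^ p" "k < 2 ^ p"
  shows "(\<Sum>j<2 ^ p :: nat. (- 1) ^ bit_dot p i j * (- 1) ^ bit_dot p k j) =
    (if i = k then 2 ^ p else 0 :: real)"
proof -
  let ?g = "\<lambda>t b. bit_sign (bit i t) b * bit_sign (bit k t) b"
  have "(\<Sum>j<2 ^ p :: nat. (- 1) ^ bit_dot p i j * (- 1) ^ bit_dot p k j) =
      (\<Sum>j<2 ^ p :: nat. \<Prod>t<p. ?g t (bit j t))"
    by (simp add: minus_one_power_bit_dot prod.distrib)
  also have "\<dots> = (\<Prod>t<p. ?g t False + ?g t True)" by (rule sum_prod_bits)
  also have "\<dots> = (if i = k then 2 ^ p else 0)"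
  proof (cases "i = k")
    case True
    have "(\<Prod>t<p. ?g t False + ?g t True) = (\<Prod>t<p. 2)"
      using True by (intro prod.cong) (auto simp: bit_sign_def)
    then show ?thesis using True by simp
  next
    case False
    \<comment> \<open>Both numbers are below \<open>2 ^ p\<close>, so agreement on the lowest
      \<open>p\<close> bits would force \<open>i = k\<close>.\<close>
    have "\<exists>t<p. bit i t \<noteq> bit k t"
    proof (rule ccontr)
      assume "\<not> ?thesis"
      then have "take_bit p i = take_bit p k" by (intro bit_eqI) (auto simp: bit_take_bit_iff)
      then show False using False assms by (simp add: take_bit_nat_eq_self)
    qed
    then obtain t where "t < p" "bit i t \<noteq> bit k t" by blast
    then have "?g t False + ?g t True = 0" by (auto simp: bit_sign_def)
    then show ?thesis using \<open>t < p\<close> False by (auto intro!: prod_zero)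
  qed
  finally show ?thesis .
qed

lemma walsh_hadamard_square:
  assumes "i < 2 ^ p" "j < 2 ^ p"
  shows "(walsh_hadamard p $$ (i, j))\<^sup>2 = 1 / 2 ^ p"
  using assms by (simp add: walsh_hadamard_def power_divide flip: power_mult)

lemma walsh_hadamard_rows:
  assumes "i < 2 ^ p" "k < 2 ^ p"
  shows "(\<Sum>j<2 ^ p. walsh_hadamard p $$ (i, j) * walsh_hadamard p $$ (k, j)) = of_bool (i = k)"
proof -
  have "(\<Sum>j<2 ^ p. walsh_hadamard p $$ (i, j) * walsh_hadamard p $$ (k, j)) =
      (\<Sum>j<2 ^ p :: nat. (- 1) ^ bit_dot p i j * (- 1) ^ bit_dot p k j) / 2 ^ p"
    using assms by (simp add: walsh_hadamard_def sum_divide_distrib)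
  then show ?thesis by (simp add: bit_dot_orthogonal[OF assms])
qed

section \<open>The potential and one gate\<close>

text \<open>For an orthogonal \<open>M\<close> with \<open>V\<close> its transpose the products are
  squared entries, and this is the sum of the base-2 Shannon entropies of the first \<open>n\<close>
  columns. For an invertible \<open>M\<close> with inverse \<open>V\<close> the products in a column
  still sum to 1, but may be negative.\<close>

definition quasi_entropy :: "nat \<Rightarrow> real mat \<Rightarrow> real mat \<Rightarrow> real" where
  "quasi_entropy n M V = - (\<Sum>r<dim_row M. \<Sum>s<n. tlog (M $$ (r, s) * V $$ (s, r)))"

text \<open>Primed values belong to the state after the gate: \<open>x, y\<close> come from two rows
  of \<open>M\<close> and \<open>u, v\<close> from two columns of \<open>V\<close>, the latter
  expressed backwards because \<open>V = V' * gate_mat d g\<close>. A rotation keeps the scalar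
  product of the pairs and both lengths, so one product of lengths bounds all four terms of
  \<open>tlog_exchange\<close>.\<close>

lemma rotation_tlog_exchange:
  fixes c s x y u v x' y' u' v' :: real
  assumes cs: "c\<^sup>2 + s\<^sup>2 = 1"
    and x': "x' = c * x + s * y" and y': "y' = - s * x + c * y"
    and u: "u = c * u' - s * v'" and v: "v = s * u' + c * v'"
  shows "\<bar>tlog (x' * u') + tlog (y' * v') - (tlog (x * u) + tlog (y * v))\<bar>
    \<le> 8 * (sqrt (x'\<^sup>2 + y'\<^sup>2) * sqrt (u'\<^sup>2 + v'\<^sup>2))"
proof (rule tlog_exchange)
  have "x'\<^sup>2 + y'\<^sup>2 = (c\<^sup>2 + s\<^sup>2) * (x\<^sup>2 + y\<^sup>2)" "u\<^sup>2 + v\<^sup>2 = (c\<^sup>2 + s\<^sup>2) * (u'\<^sup>2 + v'\<^sup>2)"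
    by (simp_all add: x' y' u v power2_eq_square algebra_simps)
  then have eq: "x'\<^sup>2 + y'\<^sup>2 = x\<^sup>2 + y\<^sup>2" "u\<^sup>2 + v\<^sup>2 = u'\<^sup>2 + v'\<^sup>2"
    using cs by simp_all
  show "x' * u' + y' * v' = x * u + y * v"
    by (simp add: x' y' u v algebra_simps)
  have b: "\<bar>p * q\<bar> \<le> sqrt a * sqrt b" if "p\<^sup>2 \<le> a" "q\<^sup>2 \<le> b" for a b p q :: real
    unfolding abs_mult by (intro mult_mono real_le_rsqrt) (use that order_trans[OF zero_le_power2 that(1)] in auto)
  show "\<bar>x' * u'\<bar> \<le> sqrt (x'\<^sup>2 + y'\<^sup>2) * sqrt (u'\<^sup>2 + v'\<^sup>2)"
    "\<bar>y' * v'\<bar> \<le> sqrt (x'\<^sup>2 + y'\<^sup>2) * sqrt (u'\<^sup>2 + v'\<^sup>2)" by (intro b; simp)+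
  show "\<bar>x * u\<bar> \<le> sqrt (x'\<^sup>2 + y'\<^sup>2) * sqrt (u'\<^sup>2 + v'\<^sup>2)"
    "\<bar>y * v\<bar> \<le> sqrt (x'\<^sup>2 + y'\<^sup>2) * sqrt (u'\<^sup>2 + v'\<^sup>2)"
    unfolding eq(1) eq(2)[symmetric] by (intro b; simp)+
qed

section \<open>Entries of products with a gate matrix, and the size of two rows or two
  columns\<close>

lemma sum_eq_two_terms:
  fixes f :: "nat \<Rightarrow> 'a :: comm_monoid_add"
  assumes "k < d" "l < d" "k \<noteq> l" "\<And>q. q < d \<Longrightarrow> q \<noteq> k \<Longrightarrow> q \<noteq> l \<Longrightarrow> f q = 0"
  shows "(\<Sum>q<d. f q) = f k + f l"
proof -
  have "(\<Sum>q<d. f q) = (\<Sum>q\<in>{k, l}. f q)"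
    by (rule sum.mono_neutral_right) (use assms in auto)
  then show ?thesis using assms(3) by simp
qed

lemma sum_eq_one_term:
  fixes f :: "nat \<Rightarrow> 'a :: comm_monoid_add"
  assumes "k < d" "\<And>q. q < d \<Longrightarrow> q \<noteq> k \<Longrightarrow> f q = 0"
  shows "(\<Sum>q<d. f q) = f k"
proof -
  have "(\<Sum>q<d. f q) = (\<Sum>q\<in>{k}. f q)"
    by (rule sum.mono_neutral_right) (use assms in auto)
  then show ?thesis by simp
qed

lemma gate_mat_mult_index:
  assumes "valid_gate d g" "M \<in> carrier_mat d d" "r < d" "s < d"
  shows "(gate_mat d g * M) $$ (r, s) = apply_gate g (col M s) $ r"
proof -
  have "(gate_mat d g * M) $$ (r, s) = (gate_mat d g *\<^sub>v col M s) $ r"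
    using assms carrier_matD[OF gate_mat_carrier[of d g]] by simp
  then show ?thesis using gate_mat_apply[OF assms(1), of "col M s"] assms(2,4) by simp
qed

lemma mult_gate_mat_index:
  assumes "V \<in> carrier_mat d d" "r < d" "s < d"
  shows "(V * gate_mat d g) $$ (s, r) = (\<Sum>q<d. V $$ (s, q) * apply_gate g (unit_vec d r) $ q)"
  using assms carrier_matD[OF gate_mat_carrier[of d g]]
  by (auto simp: scalar_prod_def gate_mat_def atLeast0LessThan intro!: sum.cong)

lemma two_rows_le_spectral_norm:
  assumes "k < dim_row A" "l < dim_row A" "n \<le> dim_col A"
  shows "L2_set (\<lambda>s. sqrt ((A $$ (k, s))\<^sup>2 + (A $$ (l, s))\<^sup>2)) {..<n} \<le> sqrt 2 * spectral_norm A"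
proof -
  have part: "(\<Sum>s<n. (A $$ (r, s))\<^sup>2) \<le> (spectral_norm A)\<^sup>2" if "r < dim_row A" for r
    using sum_mono2[of "{..<dim_col A}" "{..<n}" "\<lambda>s. (A $$ (r, s))\<^sup>2"] assms(3)
      row_le_spectral_norm[OF that] by force
  have "(\<Sum>s<n. (sqrt ((A $$ (k, s))\<^sup>2 + (A $$ (l, s))\<^sup>2))\<^sup>2) \<le> 2 * (spectral_norm A)\<^sup>2"
    using part[OF assms(1)] part[OF assms(2)] by (simp add: sum.distrib)
  then have "L2_set (\<lambda>s. sqrt ((A $$ (k, s))\<^sup>2 + (A $$ (l, s))\<^sup>2)) {..<n}
      \<le> sqrt (2 * (spectral_norm A)\<^sup>2)"
    unfolding L2_set_def by (rule real_sqrt_le_mono)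
  then show ?thesis using spectral_norm_nonneg[of A] by (simp add: real_sqrt_mult)
qed

lemma two_columns_le_spectral_norm:
  assumes "k < dim_col A" "l < dim_col A" "n \<le> dim_row A"
  shows "L2_set (\<lambda>s. sqrt ((A $$ (s, k))\<^sup>2 + (A $$ (s, l))\<^sup>2)) {..<n} \<le> sqrt 2 * spectral_norm A"
proof -
  have part: "(\<Sum>s<n. (A $$ (s, r))\<^sup>2) \<le> (spectral_norm A)\<^sup>2" if "r < dim_col A" for r
    using sum_mono2[of "{..<dim_row A}" "{..<n}" "\<lambda>s. (A $$ (s, r))\<^sup>2"] assms(3)
      column_le_spectral_norm[OF that] by force
  have "(\<Sum>s<n. (sqrt ((A $$ (s, k))\<^sup>2 + (A $$ (s, l))\<^sup>2))\<^sup>2) \<le> 2 * (spectral_norm A)\<^sup>2"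
    using part[OF assms(1)] part[OF assms(2)] by (simp add: sum.distrib)
  then have "L2_set (\<lambda>s. sqrt ((A $$ (s, k))\<^sup>2 + (A $$ (s, l))\<^sup>2)) {..<n}
      \<le> sqrt (2 * (spectral_norm A)\<^sup>2)"
    unfolding L2_set_def by (rule real_sqrt_le_mono)
  then show ?thesis using spectral_norm_nonneg[of A] by (simp add: real_sqrt_mult)
qed

text \<open>All estimates go through the matrices after the gate, whose norms \<open>R\<close>
  controls. Only the rows touched by the gate can change their terms.\<close>

lemma quasi_entropy_gate:
  assumes g: "valid_gate d g" and n: "n \<le> d"
    and M: "M \<in> carrier_mat d d" and V': "V' \<in> carrier_mat d d"
    and M': "M' = gate_mat d g * M" and V: "V = V' * gate_mat d g"
    and R: "spectral_norm M' * spectral_norm V' \<le> R"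
  shows "\<bar>quasi_entropy n M' V' - quasi_entropy n M V\<bar> \<le> 16 * R"
proof -
  have dims: "dim_row M = d" "dim_row M' = d" "dim_col M' = d" "dim_row V' = d" "dim_col V' = d"
    using M V' M' carrier_matD[OF gate_mat_carrier[of d g]] by auto
  have Mi: "M' $$ (r, s) = apply_gate g (col M s) $ r" if "r < d" "s < d" for r s
    unfolding M' by (rule gate_mat_mult_index[OF g M that])
  have Vi: "V $$ (s, r) = (\<Sum>q<d. V' $$ (s, q) * apply_gate g (unit_vec d r) $ q)"
    if "r < d" "s < d" for r s
    unfolding V by (rule mult_gate_mat_index[OF V' that])
  define D where "D r s = tlog (M' $$ (r, s) * V' $$ (s, r)) - tlog (M $$ (r, s) * V $$ (s, r))" for r s
  have diff: "quasi_entropy n M' V' - quasi_entropy n M V = - (\<Sum>r<d. \<Sum>s<n. D r s)"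
    by (simp add: quasi_entropy_def dims D_def sum_subtractf)
  have "0 \<le> R"
    using R spectral_norm_nonneg mult_nonneg_nonneg by (meson order_trans)
  show ?thesis
  proof (cases g)
    case (Constant k c)
    then have k: "k < d" and c: "c \<noteq> 0" using g by auto
    \<comment> \<open>For \<open>r = k\<close> the factor \<open>c\<close> sits on row
      \<open>k\<close> of \<open>M\<close> after the gate and on column \<open>k\<close> of
      \<open>V\<close> before it, so both products equal
      \<open>c * M $$ (k, s) * V' $$ (s, k)\<close>.\<close>
    have "D r s = 0" if "r < d" "s < n" for r s
    proof -
      have s: "s < d" using that n by simp
      have "V $$ (s, r) = V' $$ (s, r) * apply_gate g (unit_vec d r) $ r"
        unfolding Vi[OF that(1) s]
        by (rule sum_eq_one_term[OF that(1)]) (use k Constant that(1) in auto)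
      then have "M' $$ (r, s) * V' $$ (s, r) = M $$ (r, s) * V $$ (s, r)"
        using Mi[OF that(1) s] Constant that(1) s k M by auto
      then show ?thesis by (simp add: D_def)
    qed
    then have "(\<Sum>r<d. \<Sum>s<n. D r s) = 0" by simp
    then show ?thesis using diff \<open>0 \<le> R\<close> by simp
  next
    case (Rotation k l \<theta>)
    then have kl: "k < d" "l < d" "k \<noteq> l" using g by auto
    define a where "a s = sqrt ((M' $$ (k, s))\<^sup>2 + (M' $$ (l, s))\<^sup>2)" for s
    define b where "b s = sqrt ((V' $$ (s, k))\<^sup>2 + (V' $$ (s, l))\<^sup>2)" for s
    have zero: "D r s = 0" if "r < d" "s < n" "r \<noteq> k" "r \<noteq> l" for r s
    proof -
      have s: "s < d" using that n by simp
      have "V $$ (s, r) = V' $$ (s, r) * apply_gate g (unit_vec d r) $ r"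
        unfolding Vi[OF that(1) s]
        by (rule sum_eq_one_term[OF that(1)]) (use kl Rotation that in auto)
      then have "M' $$ (r, s) * V' $$ (s, r) = M $$ (r, s) * V $$ (s, r)"
        using Mi[OF that(1) s] Rotation that s M by auto
      then show ?thesis by (simp add: D_def)
    qed
    have two: "\<bar>D k s + D l s\<bar> \<le> 8 * (a s * b s)" if "s < n" for s
    proof -
      have s: "s < d" using that n by simp
      have "V $$ (s, r) = V' $$ (s, k) * apply_gate g (unit_vec d r) $ k
          + V' $$ (s, l) * apply_gate g (unit_vec d r) $ l" if "r = k \<or> r = l" for r
      proof -
        have r: "r < d" using that kl by auto
        show ?thesis
          unfolding Vi[OF r s]
          by (rule sum_eq_two_terms[OF kl]) (use that kl r Rotation in auto)
      qed
      then have v: "V $$ (s, k) = cos \<theta> * V' $$ (s, k) - sin \<theta> * V' $$ (s, l)"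
        "V $$ (s, l) = sin \<theta> * V' $$ (s, k) + cos \<theta> * V' $$ (s, l)"
        using kl Rotation by simp_all
      have m: "M' $$ (k, s) = cos \<theta> * M $$ (k, s) + sin \<theta> * M $$ (l, s)"
        "M' $$ (l, s) = - sin \<theta> * M $$ (k, s) + cos \<theta> * M $$ (l, s)"
        using Mi s kl Rotation M by simp_all
      have "\<bar>tlog (M' $$ (k, s) * V' $$ (s, k)) + tlog (M' $$ (l, s) * V' $$ (s, l))
          - (tlog (M $$ (k, s) * V $$ (s, k)) + tlog (M $$ (l, s) * V $$ (s, l)))\<bar> \<le> 8 * (a s * b s)"
        unfolding a_def b_def by (rule rotation_tlog_exchange[OF _ m v]) simp
      then show ?thesis by (simp add: D_def algebra_simps)
    qed
    have ab: "0 \<le> a s" "0 \<le> b s" for s by (simp_all add: a_def b_def)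
    have "(\<Sum>r<d. \<Sum>s<n. D r s) = (\<Sum>s<n. D k s) + (\<Sum>s<n. D l s)"
      by (rule sum_eq_two_terms[OF kl]) (simp add: zero)
    also have "\<dots> = (\<Sum>s<n. D k s + D l s)" by (simp add: sum.distrib)
    finally have "\<bar>quasi_entropy n M' V' - quasi_entropy n M V\<bar> = \<bar>\<Sum>s<n. D k s + D l s\<bar>"
      by (simp add: diff)
    also have "\<dots> \<le> (\<Sum>s<n. 8 * (a s * b s))"
      by (rule order_trans[OF sum_abs sum_mono]) (use two in simp)
    also have "\<dots> = 8 * (\<Sum>s<n. \<bar>a s\<bar> * \<bar>b s\<bar>)"
      using ab by (simp add: sum_distrib_left)
    \<comment> \<open>Cauchy-Schwarz over the columns \<open>s\<close>. Each length then costs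
      \<open>sqrt 2\<close>, as two rows or two columns are involved, which turns 8 into 16.\<close>
    also have "\<dots> \<le> 8 * (L2_set a {..<n} * L2_set b {..<n})"
      using L2_set_mult_ineq by (intro mult_left_mono) auto
    also have "\<dots> \<le> 8 * ((sqrt 2 * spectral_norm M') * (sqrt 2 * spectral_norm V'))"
      unfolding a_def b_def
      by (intro mult_left_mono mult_mono two_rows_le_spectral_norm two_columns_le_spectral_norm)
        (use kl n dims spectral_norm_nonneg in auto)
    also have "\<dots> = 16 * (spectral_norm M' * spectral_norm V')"
      by simp
    also have "\<dots> \<le> 16 * R" using R by simp
    finally show ?thesis .
  qed
qed

section \<open>The potential along a circuit\<close>

definition inverse_matrix :: "nat \<Rightarrow> gate list \<Rightarrow> nat \<Rightarrow> real mat" where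
  "inverse_matrix d gs i = the (mat_inverse (defining_matrix d gs i))"

lemma defining_matrix_carrier: "defining_matrix d gs i \<in> carrier_mat d d"
  by (simp add: defining_matrix_def)

lemma inverse_matrix:
  assumes "layered_circuit d gs"
  shows "inverse_matrix d gs i \<in> carrier_mat d d"
    "defining_matrix d gs i * inverse_matrix d gs i = 1\<^sub>m d"
    "inverse_matrix d gs i * defining_matrix d gs i = 1\<^sub>m d"
proof -
  obtain B where "mat_inverse (defining_matrix d gs i) = Some B"
    using mat_inverse_defining_matrix[OF assms] by blast
  then show "inverse_matrix d gs i \<in> carrier_mat d d"
    "defining_matrix d gs i * inverse_matrix d gs i = 1\<^sub>m d"
    "inverse_matrix d gs i * defining_matrix d gs i = 1\<^sub>m d"
    using mat_inverse(2)[OF defining_matrix_carrier] by (simp_all add: inverse_matrix_def)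
qed

lemma defining_matrix_0: "defining_matrix d gs 0 = 1\<^sub>m d"
  by (rule mat_eq_defining_matrix[symmetric]) (auto simp: layer_def)

lemma defining_matrix_Suc:
  assumes c: "layered_circuit d gs" and i: "i < length gs"
  shows "defining_matrix d gs (Suc i) = gate_mat d (gs ! i) * defining_matrix d gs i"
proof (rule mat_eq_defining_matrix[symmetric])
  show "gate_mat d (gs ! i) * defining_matrix d gs i \<in> carrier_mat d d"
    by (rule mult_carrier_mat[OF gate_mat_carrier defining_matrix_carrier])
  have g: "valid_gate d (gs ! i)" using c i by (simp add: layered_circuit_def)
  have Mx: "defining_matrix d gs i *\<^sub>v x = layer gs x i" if "x \<in> carrier_vec d" for x
    using defining_matrix_unique[OF c, of "defining_matrix d gs i" i] that by blast
  show "\<forall>x\<in>carrier_vec d. (gate_mat d (gs ! i) * defining_matrix d gs i) *\<^sub>v x = layer gs x (Suc i)"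
  proof
    fix x :: "real vec" assume x: "x \<in> carrier_vec d"
    show "(gate_mat d (gs ! i) * defining_matrix d gs i) *\<^sub>v x = layer gs x (Suc i)"
      using i gate_mat_apply[OF g fold_apply_gate_carrier[OF x]]
      by (simp add: assoc_mult_mat_vec[OF gate_mat_carrier defining_matrix_carrier x] Mx[OF x]
          layer_def take_Suc_conv_app_nth)
  qed
qed

text \<open>With \<open>g\<close> the gate matrix,
  \<open>V = (V' (g M)) V = (V' g) (M V) = V' g\<close>; the inverse is peeled off without inverting
  the gate.\<close>

lemma inverse_matrix_Suc:
  assumes c: "layered_circuit d gs" and i: "i < length gs"
  shows "inverse_matrix d gs i = inverse_matrix d gs (Suc i) * gate_mat d (gs ! i)"
proof -
  let ?M = "defining_matrix d gs i" and ?V = "inverse_matrix d gs i"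
    and ?V' = "inverse_matrix d gs (Suc i)" and ?g = "gate_mat d (gs ! i)"
  note [simp] = gate_mat_carrier defining_matrix_carrier inverse_matrix(1)[OF c]
  have "?V = (?V' * (?g * ?M)) * ?V"
    using inverse_matrix(3)[OF c, of "Suc i"] unfolding defining_matrix_Suc[OF c i]
    by (simp add: left_mult_one_mat[OF inverse_matrix(1)[OF c]])
  also have "?V' * (?g * ?M) = (?V' * ?g) * ?M"
    by (rule assoc_mult_mat[of _ d d _ d _ d, symmetric]) simp_all
  also have "(?V' * ?g) * ?M * ?V = (?V' * ?g) * (?M * ?V)"
    by (rule assoc_mult_mat[of _ d d _ d _ d]) (auto intro: mult_carrier_mat[of _ d d])
  also have "\<dots> = ?V' * ?g"
    unfolding inverse_matrix(2)[OF c]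
    by (rule right_mult_one_mat[OF mult_carrier_mat[OF inverse_matrix(1)[OF c] gate_mat_carrier]])
  finally show ?thesis .
qed

lemma inverse_matrix_0:
  assumes "layered_circuit d gs"
  shows "inverse_matrix d gs 0 = 1\<^sub>m d"
  using inverse_matrix(2)[OF assms, of 0] left_mult_one_mat[OF inverse_matrix(1)[OF assms, of 0]]
  by (simp add: defining_matrix_0)

lemma quasi_entropy_circuit:
  assumes c: "layered_circuit d gs" and R: "uniformly_well_conditioned R d gs" and n: "n \<le> d"
  shows "i \<le> length gs \<Longrightarrow>
    quasi_entropy n (defining_matrix d gs i) (inverse_matrix d gs i) \<le> 16 * R * real i"
proof (induction i)
  case 0
  \<comment> \<open>The products of entries of the identity are 0 or 1, both zeros of
    \<open>tlog\<close>.\<close>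
  have "tlog ((1\<^sub>m d :: real mat) $$ (r, s) * 1\<^sub>m d $$ (s, r)) = 0" if "r < d" "s < n" for r s
    using that n by (cases "r = s") (simp_all add: tlog_def)
  then show ?case
    by (simp add: defining_matrix_0 inverse_matrix_0[OF c] quasi_entropy_def)
next
  case (Suc i)
  then have i: "i < length gs" by simp
  \<comment> \<open>The conditioning hypothesis is indexed from 1 and list positions from 0: the
    matrices after \<open>gs ! i\<close> have index \<open>Suc i\<close>.\<close>
  have "spectral_norm (defining_matrix d gs (Suc i)) * spectral_norm (inverse_matrix d gs (Suc i)) \<le> R"
    using R i unfolding uniformly_well_conditioned_def inverse_matrix_def by force
  moreover have "valid_gate d (gs ! i)" using c i by (simp add: layered_circuit_def)
  ultimately have "\<bar>quasi_entropy n (defining_matrix d gs (Suc i)) (inverse_matrix d gs (Suc i))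
      - quasi_entropy n (defining_matrix d gs i) (inverse_matrix d gs i)\<bar> \<le> 16 * R"
    using n by (intro quasi_entropy_gate[OF _ _ defining_matrix_carrier inverse_matrix(1)[OF c]
        defining_matrix_Suc[OF c i] inverse_matrix_Suc[OF c i]])
  then show ?case using Suc by (simp add: algebra_simps)
qed

section \<open>The potential of the final matrix\<close>

lemma sum_split:
  fixes f :: "nat \<Rightarrow> 'a :: comm_monoid_add"
  shows "(\<Sum>r<n + N. f r) = (\<Sum>r<n. f r) + (\<Sum>k<N. f (n + k))"
  by (induction N) (simp_all add: add.assoc)

lemma l2_norm_square: "(l2_norm v)\<^sup>2 = (\<Sum>i<dim_vec v. (v $ i)\<^sup>2)"
  by (simp add: l2_norm_def L2_set_def sum_nonneg)

section \<open>Entries of the input block and of the memory block\<close>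

lemma pick_lessThan:
  assumes "i < n"
  shows "pick {..<n} i = i"
proof -
  have "{a \<in> {..<n}. a < i} = {..<i}" using assms by auto
  then show ?thesis using pick_card_in_set[of i "{..<n}"] assms by simp
qed

text \<open>\<open>pick I k\<close> is the element of \<open>I\<close> with exactly \<open>k\<close>
  smaller elements in \<open>I\<close>; for \<open>n + k\<close> these are the numbers from
  \<open>n\<close> to \<open>n + k - 1\<close>.\<close>

lemma pick_Diff_lessThan:
  assumes "k < N"
  shows "pick ({..<n + N} - {..<n}) k = n + k"
proof -
  have "{a \<in> {..<n + N} - {..<n}. a < n + k} = {n..<n + k}" using assms by auto
  then show ?thesis using pick_card_in_set[of "n + k" "{..<n + N} - {..<n}"] assms by simp
qed

lemma submatrix_top:
  assumes "M \<in> carrier_mat (n + N) (n + N)" "i < n" "j < n"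
  shows "submatrix M {..<n} {..<n} $$ (i, j) = M $$ (i, j)"
proof -
  have "{i. i < n + N \<and> i \<in> {..<n}} = {..<n}" by auto
  then show ?thesis using assms by (subst submatrix_index) (auto simp: pick_lessThan)
qed

lemma submatrix_bottom:
  assumes "M \<in> carrier_mat (n + N) (n + N)"
  shows "submatrix M ({..<n + N} - {..<n}) {..<n} = mat N n (\<lambda>(k, j). M $$ (n + k, j))"
proof -
  let ?I = "{..<n + N} - {..<n}" and ?J = "{..<n}"
  have "{j. j < dim_col M \<and> j \<in> ?J} = {..<n}" "{i. i < dim_row M \<and> i \<in> ?I} = {n..<n + N}"
    using assms by auto
  then have card: "card {j. j < dim_col M \<and> j \<in> ?J} = n" "card {i. i < dim_row M \<and> i \<in> ?I} = N"
    by (simp_all only: card_lessThan card_atLeastLessThan diff_add_inverse)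
  show ?thesis
  proof (rule eq_matI)
    fix k j assume "k < dim_row (mat N n (\<lambda>(k, j). M $$ (n + k, j)))"
      "j < dim_col (mat N n (\<lambda>(k, j). M $$ (n + k, j)))"
    then have kj: "k < N" "j < n" by simp_all
    show "submatrix M ?I ?J $$ (k, j) = mat N n (\<lambda>(k, j). M $$ (n + k, j)) $$ (k, j)"
      using kj by (subst submatrix_index) (simp_all only: card pick_lessThan pick_Diff_lessThan index_mat case_prod_conv)
  qed (simp_all only: dim_submatrix card dim_row_mat dim_col_mat)
qed

text \<open>Writing \<open>f\<close> for row \<open>i\<close> of the orthogonal block and \<open>G\<close> for the block below it,
  \<open>M (f, 0) = (e\<^sub>i, G f)\<close>; applying \<open>V\<close> shows that column \<open>i\<close> of \<open>V\<close> differs from \<open>(f, 0)\<close>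
  by \<open>V (0, G f)\<close>.\<close>

lemma inverse_near_orthogonal_block:
  assumes M: "M \<in> carrier_mat (n + N) (n + N)" and V: "V \<in> carrier_mat (n + N) (n + N)"
    and VM: "V * M = 1\<^sub>m (n + N)"
    and orth: "\<And>i k. i < n \<Longrightarrow> k < n \<Longrightarrow> (\<Sum>j<n. M $$ (i, j) * M $$ (k, j)) = of_bool (i = k)"
    and i: "i < n"
  shows "(\<Sum>j<n. (V $$ (j, i) - M $$ (i, j))\<^sup>2)
    \<le> (spectral_norm V * spectral_norm (mat N n (\<lambda>(k, j). M $$ (n + k, j))))\<^sup>2"
proof -
  let ?d = "n + N" and ?G = "mat N n (\<lambda>(k, j). M $$ (n + k, j))"
  define f where "f = vec n (\<lambda>j. M $$ (i, j))"
  define x where "x = vec ?d (\<lambda>r. if r < n then f $ r else 0)"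
  define w where "w = vec ?d (\<lambda>r. if r < n then 0 else (?G *\<^sub>v f) $ (r - n))"
  have car: "f \<in> carrier_vec n" "x \<in> carrier_vec ?d" "w \<in> carrier_vec ?d"
    by (simp_all add: f_def x_def w_def)
  have "M *\<^sub>v x = unit_vec ?d i + w"
  proof (rule eq_vecI)
    fix r assume "r < dim_vec (unit_vec ?d i + w)"
    then have r: "r < ?d" by (simp add: w_def)
    have "(M *\<^sub>v x) $ r = (\<Sum>q<?d. M $$ (r, q) * x $ q)"
      using r M car by (auto simp: scalar_prod_def atLeast0LessThan intro!: sum.cong)
    also have "\<dots> = (\<Sum>j<n. M $$ (r, j) * M $$ (i, j))"
      unfolding sum_split by (simp add: x_def f_def)
    also have "\<dots> = (unit_vec ?d i + w) $ r"
    proof (cases "r < n")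
      case True
      then show ?thesis using r i orth[of r i] by (simp add: w_def of_bool_def)
    next
      case False
      then show ?thesis
        using r i by (simp add: w_def scalar_prod_def f_def atLeast0LessThan)
    qed
    finally show "(M *\<^sub>v x) $ r = (unit_vec ?d i + w) $ r" .
  qed (use M in \<open>simp add: w_def\<close>)
  then have "V *\<^sub>v (M *\<^sub>v x) = V *\<^sub>v unit_vec ?d i + V *\<^sub>v w"
    using mult_add_distrib_mat_vec[OF V _ car(3), of "unit_vec ?d i"] by simp
  moreover have "V *\<^sub>v (M *\<^sub>v x) = x"
    using assoc_mult_mat_vec[OF V M car(2)] VM car(2) by simp
  ultimately have x_eq: "x = V *\<^sub>v unit_vec ?d i + V *\<^sub>v w" by simp
  have err: "V $$ (j, i) - M $$ (i, j) = - (V *\<^sub>v w) $ j" if j: "j < n" for j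
  proof -
    have "x $ j = (V *\<^sub>v unit_vec ?d i) $ j + (V *\<^sub>v w) $ j"
      by (subst x_eq) (use j V in simp)
    then show ?thesis using j i V by (simp add: x_def f_def)
  qed
  \<comment> \<open>Row \<open>i\<close> of the orthogonal block has length 1, so its image under
    \<open>?G\<close> is bounded by \<open>spectral_norm ?G\<close>; \<open>w\<close> is that image
    padded with zeros.\<close>
  have "(l2_norm f)\<^sup>2 = 1"
    unfolding l2_norm_square using orth[OF i i] by (simp add: f_def power2_eq_square)
  then have "l2_norm f = 1" using l2_norm_nonneg[of f] by (simp add: power2_eq_1_iff)
  then have "l2_norm (?G *\<^sub>v f) \<le> spectral_norm ?G"
    using l2_norm_mult_le[of f ?G] car(1) by simp
  moreover have "(l2_norm w)\<^sup>2 = (l2_norm (?G *\<^sub>v f))\<^sup>2"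
    unfolding l2_norm_square by (simp add: w_def sum_split del: index_mult_mat_vec)
  ultimately have "l2_norm w \<le> spectral_norm ?G"
    using l2_norm_nonneg[of w] l2_norm_nonneg[of "?G *\<^sub>v f"] by (simp add: power2_eq_iff_nonneg)
  then have Vw: "l2_norm (V *\<^sub>v w) \<le> spectral_norm V * spectral_norm ?G"
    using order_trans[OF l2_norm_mult_le[of w V] mult_left_mono[OF _ spectral_norm_nonneg[of V]]]
      car(3) V by auto
  have "(\<Sum>j<n. (V $$ (j, i) - M $$ (i, j))\<^sup>2) = (\<Sum>j<n. ((V *\<^sub>v w) $ j)\<^sup>2)"
    by (intro sum.cong) (simp_all add: err del: index_mult_mat_vec)
  also have "\<dots> \<le> (l2_norm (V *\<^sub>v w))\<^sup>2"
    unfolding l2_norm_square using V by (intro sum_mono2) auto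
  also have "\<dots> \<le> (spectral_norm V * spectral_norm ?G)\<^sup>2"
    using Vw l2_norm_nonneg by (intro power_mono)
  finally show ?thesis .
qed

text \<open>Cauchy-Schwarz over the memory coordinates: one factor is a column of the lower left
  block, the other a piece of a row of \<open>V\<close>.\<close>

lemma column_product_sum_le:
  assumes V: "V \<in> carrier_mat (n + N) (n + N)" and j: "j < n"
  shows "(\<Sum>k<N. \<bar>M $$ (n + k, j) * V $$ (j, n + k)\<bar>)
    \<le> spectral_norm V * spectral_norm (mat N n (\<lambda>(k, j). M $$ (n + k, j)))"
proof -
  let ?G = "mat N n (\<lambda>(k, j). M $$ (n + k, j))"
  have "(\<Sum>k<N. \<bar>M $$ (n + k, j) * V $$ (j, n + k)\<bar>)
      \<le> L2_set (\<lambda>k. M $$ (n + k, j)) {..<N} * L2_set (\<lambda>k. V $$ (j, n + k)) {..<N}"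
    using L2_set_mult_ineq by (simp add: abs_mult)
  also have "\<dots> \<le> spectral_norm ?G * spectral_norm V"
  proof (rule mult_mono)
    have "(\<Sum>k<N. (M $$ (n + k, j))\<^sup>2) \<le> (spectral_norm ?G)\<^sup>2"
      using column_le_spectral_norm[of j ?G] j by simp
    then show "L2_set (\<lambda>k. M $$ (n + k, j)) {..<N} \<le> spectral_norm ?G"
      unfolding L2_set_def using spectral_norm_nonneg by (simp add: real_le_lsqrt)
    have "(\<Sum>k<N. (V $$ (j, n + k))\<^sup>2) \<le> (\<Sum>r<n + N. (V $$ (j, r))\<^sup>2)"
      unfolding sum_split by (simp add: sum_nonneg)
    also have "\<dots> \<le> (spectral_norm V)\<^sup>2"
      using row_le_spectral_norm[of j V] j V by simp
    finally show "L2_set (\<lambda>k. V $$ (j, n + k)) {..<N} \<le> spectral_norm V"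
      unfolding L2_set_def using spectral_norm_nonneg by (simp add: real_le_lsqrt)
  qed (simp_all add: spectral_norm_nonneg)
  finally show ?thesis by (simp add: mult.commute)
qed

text \<open>The first column of the top block has \<open>n\<close> entries with square
  \<open>1 / n\<close>, hence length 1. This lets a bound on the product of the norms of
  \<open>M\<close> and its inverse pass to the inverse alone.\<close>

lemma one_le_spectral_norm_of_top_block:
  assumes M: "M \<in> carrier_mat (n + N) (n + N)" and n: "0 < n"
    and sq: "\<And>i j. i < n \<Longrightarrow> j < n \<Longrightarrow> (M $$ (i, j))\<^sup>2 = 1 / real n"
  shows "1 \<le> spectral_norm M"
proof -
  have "1 = (\<Sum>i<n. (M $$ (i, 0))\<^sup>2)" using n sq by simp
  also have "\<dots> \<le> (\<Sum>i<n + N. (M $$ (i, 0))\<^sup>2)"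
    unfolding sum_split by (simp add: sum_nonneg)
  also have "\<dots> \<le> (spectral_norm M)\<^sup>2"
    using column_le_spectral_norm[of 0 M] M n by simp
  finally show ?thesis
    using spectral_norm_nonneg[of M] power2_le_imp_le[of 1 "spectral_norm M"] by simp
qed

text \<open>With \<open>L = log 2 n\<close>, the input coordinates give at least
  \<open>3/4 n L\<close> and the memory takes away at most \<open>n L / 2 + 2 L\<close>. The
  remaining \<open>n L / 4 - 2 L\<close> is at least \<open>n L / 8\<close> once
  \<open>n \<ge> 16\<close>.\<close>

lemma quasi_entropy_final:
  fixes C0 :: real
  assumes C0: "0 < C0" "C0 < 1 / 4"
    and hyp: "\<And>\<epsilon>. \<epsilon> \<in> carrier_vec n \<Longrightarrow> l2_norm \<epsilon> \<le> C0 \<Longrightarrow>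
      - (\<Sum>i<n. 1 / sqrt (real n) * (1 / sqrt (real n) + \<epsilon> $ i) *
            log 2 \<bar>1 / sqrt (real n) * (1 / sqrt (real n) + \<epsilon> $ i)\<bar>)
        \<ge> 3 / 4 * log 2 (real n)"
    and n: "16 \<le> n" and N: "real N \<le> real n * log 2 (real n)"
    and M: "M \<in> carrier_mat (n + N) (n + N)" and V: "V \<in> carrier_mat (n + N) (n + N)"
    and VM: "V * M = 1\<^sub>m (n + N)"
    and orth: "\<And>i k. i < n \<Longrightarrow> k < n \<Longrightarrow> (\<Sum>j<n. M $$ (i, j) * M $$ (k, j)) = of_bool (i = k)"
    and sq: "\<And>i j. i < n \<Longrightarrow> j < n \<Longrightarrow> (M $$ (i, j))\<^sup>2 = 1 / real n"
    and G: "spectral_norm V * spectral_norm (mat N n (\<lambda>(k, j). M $$ (n + k, j))) \<le> C0"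
  shows "real n * log 2 (real n) / 8 \<le> quasi_entropy n M V"
proof -
  let ?G = "mat N n (\<lambda>(k, j). M $$ (n + k, j))" and ?L = "log 2 (real n)"
  have n0: "0 < real n" and L: "0 \<le> ?L" using n by simp_all
  have top: "(\<Sum>j<n. tlog (M $$ (i, j) * V $$ (j, i))) \<le> - (3 / 4 * ?L)" if i: "i < n" for i
  proof -
    \<comment> \<open>Since \<open>sqrt n * M $$ (i, j)\<close> is 1 or -1, this is the deviation of
      \<open>V\<close> from the transposed block with signs normalized: lengths are unchanged, and
      the products take exactly the form of the entropy hypothesis.\<close>
    define \<epsilon> where "\<epsilon> = vec n (\<lambda>j. sqrt (real n) * M $$ (i, j) * (V $$ (j, i) - M $$ (i, j)))"
    have "(l2_norm \<epsilon>)\<^sup>2 = (\<Sum>j<n. (V $$ (j, i) - M $$ (i, j))\<^sup>2)"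
      unfolding l2_norm_square
      by (rule sum.cong) (use n0 i in \<open>auto simp: \<epsilon>_def power_mult_distrib sq\<close>)
    also have "\<dots> \<le> (spectral_norm V * spectral_norm ?G)\<^sup>2"
      by (rule inverse_near_orthogonal_block[OF M V VM orth i])
    also have "\<dots> \<le> C0\<^sup>2"
      using G spectral_norm_nonneg by (intro power_mono) auto
    finally have "l2_norm \<epsilon> \<le> C0" by (rule power2_le_imp_le) (use C0 in simp)
    moreover have "1 / sqrt (real n) * (1 / sqrt (real n) + \<epsilon> $ j) = M $$ (i, j) * V $$ (j, i)"
      if j: "j < n" for j
    proof -
      have "1 / sqrt (real n) * (1 / sqrt (real n) + \<epsilon> $ j)
          = 1 / real n + M $$ (i, j) * (V $$ (j, i) - M $$ (i, j))"
        using n0 j by (simp add: \<epsilon>_def distrib_left)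
      also have "\<dots> = M $$ (i, j) * V $$ (j, i)"
        using sq[OF i j] by (simp add: power2_eq_square algebra_simps)
      finally show ?thesis .
    qed
    ultimately show ?thesis
      using hyp[of \<epsilon>] by (simp add: \<epsilon>_def tlog_def)
  qed
  have small: "\<bar>M $$ (n + k, j) * V $$ (j, n + k)\<bar> \<le> 1" if "k < N" "j < n" for k j
  proof -
    have "\<bar>M $$ (n + k, j) * V $$ (j, n + k)\<bar> \<le> (\<Sum>k<N. \<bar>M $$ (n + k, j) * V $$ (j, n + k)\<bar>)"
      by (rule member_le_sum) (use that in auto)
    then show ?thesis using column_product_sum_le[OF V that(2), of M] G C0 by linarith
  qed
  let ?t = "\<lambda>j k. \<bar>M $$ (n + k, j) * V $$ (j, n + k)\<bar>"
  have "(\<Sum>k<N. \<Sum>j<n. tlog (M $$ (n + k, j) * V $$ (j, n + k)))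
      = (\<Sum>j<n. \<Sum>k<N. tlog (M $$ (n + k, j) * V $$ (j, n + k)))"
    by (rule sum.swap)
  \<comment> \<open>The threshold \<open>1 / n\<^sup>2\<close> gives the logarithm
    \<open>2 * ?L\<close>, while the \<open>n * N\<close> error terms \<open>2 / n\<^sup>2\<close>
    total at most \<open>2 * ?L\<close> because \<open>N \<le> n * ?L\<close>.\<close>
  also have "\<dots> \<le> (\<Sum>j<n. \<Sum>k<N. ?t j k * (2 * ?L) + 2 / (real n)\<^sup>2)"
  proof (intro sum_mono)
    fix j k assume "j \<in> {..<n}" "k \<in> {..<N}"
    then have "\<bar>tlog (M $$ (n + k, j) * V $$ (j, n + k))\<bar>
        \<le> ?t j k * log 2 (1 / (1 / (real n)\<^sup>2)) + 2 * (1 / (real n)\<^sup>2)"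
      using n0 by (intro abs_tlog_le_threshold small) auto
    then show "tlog (M $$ (n + k, j) * V $$ (j, n + k)) \<le> ?t j k * (2 * ?L) + 2 / (real n)\<^sup>2"
      using n0 by (simp add: log_nat_power)
  qed
  also have "\<dots> = (\<Sum>j<n. (\<Sum>k<N. ?t j k) * (2 * ?L) + real N * (2 / (real n)\<^sup>2))"
    by (simp add: sum.distrib sum_distrib_right)
  \<comment> \<open>The mass in each column is at most \<open>C0 < 1 / 4\<close>, which leaves
    \<open>?L / 2\<close> per column.\<close>
  also have "\<dots> \<le> (\<Sum>j<n. 1 / 4 * (2 * ?L) + real n * ?L * (2 / (real n)\<^sup>2))"
  proof (intro sum_mono add_mono mult_right_mono)
    fix j assume "j \<in> {..<n}"
    then show "(\<Sum>k<N. ?t j k) \<le> 1 / 4"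
      using column_product_sum_le[OF V, of j M] G C0 by fastforce
  qed (use N L in auto)
  also have "\<dots> = real n * ?L / 2 + 2 * ?L"
    using n0 by (simp add: power2_eq_square field_simps)
  finally have bottom: "(\<Sum>k<N. \<Sum>j<n. tlog (M $$ (n + k, j) * V $$ (j, n + k)))
    \<le> real n * ?L / 2 + 2 * ?L" .
  have "(\<Sum>i<n. \<Sum>j<n. tlog (M $$ (i, j) * V $$ (j, i))) \<le> (\<Sum>i<n. - (3 / 4 * ?L))"
    by (rule sum_mono) (use top in simp)
  then have "real n * ?L / 4 - 2 * ?L \<le> quasi_entropy n M V"
    using bottom M by (simp add: quasi_entropy_def sum_split)
  moreover have "16 * ?L \<le> real n * ?L" using n L by (intro mult_right_mono) auto
  ultimately show ?thesis by linarith
qed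

theorem theorem3:
  fixes C0 :: real
  assumes "0 < C0" and "C0 < 1 / 4"
    and "\<forall>n\<ge>2. \<forall>\<epsilon>\<in>carrier_vec n. l2_norm \<epsilon> \<le> C0 \<longrightarrow>
      - (\<Sum>i<n. 1 / sqrt (real n) * (1 / sqrt (real n) + \<epsilon> $ i) *
            log 2 \<bar>1 / sqrt (real n) * (1 / sqrt (real n) + \<epsilon> $ i)\<bar>)
        \<ge> 3 / 4 * log 2 (real n)"
  shows "\<exists>c::real. c > 0 \<and>
    (\<forall>(n::nat) (p::nat) (N::nat) (R::real) (gs::gate list).
      n = 2 ^ p \<longrightarrow>
      real N \<le> real n * log 2 (real n) \<longrightarrow>
      R > 1 \<longrightarrow>
      layered_circuit (n + N) gs \<longrightarrow>
      uniformly_well_conditioned R (n + N) gs \<longrightarrow>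
      submatrix (defining_matrix (n + N) gs (length gs)) {..<n} {..<n} = walsh_hadamard p \<longrightarrow>
      spectral_norm (submatrix (defining_matrix (n + N) gs (length gs)) ({..<n + N} - {..<n}) {..<n})
        \<le> C0 / R \<longrightarrow>
      real (length gs) \<ge> c * (1 / R) * (real n * log 2 (real n)))"
\<comment> \<open>The witness is 1 / (8 * 16), from
  \<open>n log n / 8 \<le> \<Phi> \<le> 16 R m\<close>.\<close>
proof (intro exI[of _ "1 / 128"] conjI allI impI)
  fix n p N :: nat and R :: real and gs :: "gate list"
  assume np: "n = 2 ^ p" and N: "real N \<le> real n * log 2 (real n)" and R: "R > 1"
    and c: "layered_circuit (n + N) gs" and wc: "uniformly_well_conditioned R (n + N) gs"
    and F: "submatrix (defining_matrix (n + N) gs (length gs)) {..<n} {..<n} = walsh_hadamard p"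
    and G: "spectral_norm (submatrix (defining_matrix (n + N) gs (length gs))
      ({..<n + N} - {..<n}) {..<n}) \<le> C0 / R"
  let ?M = "defining_matrix (n + N) gs (length gs)" and ?V = "inverse_matrix (n + N) gs (length gs)"
    and ?L = "log 2 (real n)"
  note M = defining_matrix_carrier[of "n + N" gs "length gs"]
  have MF: "?M $$ (i, j) = walsh_hadamard p $$ (i, j)" if "i < n" "j < n" for i j
    using submatrix_top[OF M that] F by simp
  have sq: "(?M $$ (i, j))\<^sup>2 = 1 / real n" if "i < n" "j < n" for i j
    unfolding MF[OF that] using that walsh_hadamard_square[of i p j] by (simp add: np)
  have orth: "(\<Sum>j<n. ?M $$ (i, j) * ?M $$ (k, j)) = of_bool (i = k)" if "i < n" "k < n" for i k
  proof -
    have "(\<Sum>j<n. ?M $$ (i, j) * ?M $$ (k, j)) =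
        (\<Sum>j<n. walsh_hadamard p $$ (i, j) * walsh_hadamard p $$ (k, j))"
      by (intro sum.cong) (use that MF in auto)
    then show ?thesis using that walsh_hadamard_rows[of i p k] by (simp add: np)
  qed
  have L: "?L = real p" by (simp add: np log_nat_power)
  show "real (length gs) \<ge> 1 / 128 * (1 / R) * (real n * ?L)"
  proof (cases "p = 0")
    case True
    then show ?thesis by (simp add: L)
  next
    case False
    have n2: "2 \<le> n" using False np self_le_power[of 2 p] by simp
    \<comment> \<open>An empty circuit computes the identity, which has a zero off the diagonal,
      whereas every Hadamard entry has square \<open>1 / n\<close>.\<close>
    have "length gs \<noteq> 0"
    proof
      assume "length gs = 0"
      then have "?M $$ (0, 1) = 0" using n2 by (simp add: defining_matrix_0)
      then show False using sq[of 0 1] n2 by simp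
    qed
    then have m: "length gs \<in> {1..length gs}" by (simp add: Suc_le_eq)
    show ?thesis
    proof (cases "16 \<le> n")
      case True
      have VM: "spectral_norm ?M * spectral_norm ?V \<le> R"
        using wc m unfolding uniformly_well_conditioned_def inverse_matrix_def by blast
      have "1 \<le> spectral_norm ?M"
        by (rule one_le_spectral_norm_of_top_block[OF M _ sq]) (use n2 in auto)
      then have "spectral_norm ?V \<le> R"
        using VM mult_right_mono[of 1 "spectral_norm ?M" "spectral_norm ?V"] spectral_norm_nonneg[of ?V]
        by simp
      then have "spectral_norm ?V * spectral_norm (mat N n (\<lambda>(k, j). ?M $$ (n + k, j))) \<le> R * (C0 / R)"
        using G R unfolding submatrix_bottom[OF M] by (intro mult_mono spectral_norm_nonneg) auto
      also have "\<dots> = C0" using R by simp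
      finally have "real n * ?L / 8 \<le> quasi_entropy n ?M ?V"
        by (intro quasi_entropy_final[OF assms(1,2) assms(3)[rule_format, OF n2] True N M
            inverse_matrix(1)[OF c] inverse_matrix(3)[OF c] orth sq])
      also have "\<dots> \<le> 16 * R * real (length gs)"
        by (rule quasi_entropy_circuit[OF c wc]) auto
      finally show ?thesis using R by (simp add: field_simps)
    next
      case False
      have "(2::nat) ^ p < 2 ^ 4" using False np by simp
      then have "p < 4" by (simp only: power_strict_increasing_iff)
      \<comment> \<open>With \<open>1 / R \<le> 1\<close> the claimed bound is at most 64 / 128 < 1,
        so a single gate is enough.\<close>
      then have "real n * ?L \<le> 16 * 4"
        unfolding L using False by (intro mult_mono) auto
      then have "1 / 128 * (1 / R) * (real n * ?L) \<le> 1 / 128 * 1 * 64"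
        using R by (intro mult_mono) (auto simp: L)
      then show ?thesis using m by simp
    qed
  qed
qed simp

end
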